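(* Assume the rate function $f$ is convex. For the bricklayers' (BL) model, the function $\mathcal H(\varrho)$ is strictly convex. For the zero range (ZR) process, linearity of $\mathcal H(\varrho)$ is equivalent to linearity of the rate function $f$ (on the nonnegative integers); if this is not the case, then $\mathcal H(\varrho)$ is strictly convex.
   Context: Models. In the zero range (ZR) process, $I=\mathbb Z_{\ge0}$, $f:I\to[0,\infty)$ is nondecreasing with $f(0)=0$ and $f(z)>0$ for $z\ge1$, and $r(z,y)=f(z)$. In the bricklayers' (BL) model, $I=\mathbb Z$, $f:\mathbb Z\to(0,\infty)$ is nondecreasing with $f(z)f(1-z)=1$ for all $z\in\mathbb Z$, and $r(z,y)=f(z)+f(-y)$. Convexity of $f$ means $f(z+1)-f(z)\ge f(z)-f(z-1)$ whenever $z-1,z,z+1\in I$. The associated process $\underline\omega(t)=(\omega_i(t))_{i\in\mathbb Z}$ is the Markov process on $I^{\mathbb Z}$ in which, for each $i$, the jump $(\omega_i,\omega_{i+1})\to(\omega_i-1,\omega_{i+1}+1)$ occurs with rate $r(\omega_i,\omega_{i+1})$; existence of the dynamics on a set of configurations of full measure w.r.t. all the measures below is a standing assumption. Stationary measures. $f(z)!=\prod_{y=1}^zf(y)$ for $z>0$, $f(0)!=1$, and (BL) $f(z)!=1/\prod_{y=z+1}^0f(y)$ for $z<0$. Let $\bar\theta=\lim_{z\to\infty}\log f(z)$; $\underline\theta=-\infty$ for ZR and $\underline\theta=\lim_{z\to\infty}\log f(-z)$ for BL; assume $\underline\theta<\bar\theta$. For $\theta\in(\underline\theta,\bar\theta)$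 let $\mu_\theta(z)=\frac{1}{Z(\theta)}\frac{e^{\theta z}}{f(z)!}$, $z\in I$, with $Z(\theta)=\sum_{z\in I}e^{\theta z}/f(z)!$, and let $\mathbf E_\theta$ be expectation under the product measure on $I^{\mathbb Z}$ with marginals $\mu_\theta$. The function $\varrho(\theta)=\mathbf E_\theta(\omega_0)$ is strictly increasing on $(\underline\theta,\bar\theta)$; $\theta(\varrho)$ denotes its inverse, and $\mathcal H(\varrho)=\mathbf E_{\theta(\varrho)}\{r(\omega_0,\omega_1)\}$ for $\varrho$ in the range of $\varrho(\cdot)$. *)

theory Defs
  imports "HOL-Probability.Probability"
begin

datatype model = ZR | BL

text \<open>
  Both models are treated uniformly: a rate function has type \<^typ>\<open>int \<Rightarrow> real\<close>, but only its values
  on the state space of the model matter. For \<open>ZR\<close> the values at negative integers are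
  never constrained and never enter the quantities below.
\<close>

fun state_space :: "model \<Rightarrow> int set" where
  "state_space ZR = {0..}"
| "state_space BL = UNIV"

fun is_rate_function :: "model \<Rightarrow> (int \<Rightarrow> real) \<Rightarrow> bool" where
  "is_rate_function ZR f \<longleftrightarrow>
     (\<forall>z\<ge>0. f z \<ge> 0) \<and> mono_on {0..} f \<and> f 0 = 0 \<and> (\<forall>z\<ge>1. f z > 0)"
| "is_rate_function BL f \<longleftrightarrow>
     (\<forall>z. f z > 0) \<and> mono f \<and> (\<forall>z. f z * f (1 - z) = 1)"

fun jump_rate :: "model \<Rightarrow> (int \<Rightarrow> real) \<Rightarrow> int \<Rightarrow> int \<Rightarrow> real" where
  "jump_rate ZR f z y = f z"
| "jump_rate BL f z y = f z + f (- y)"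

definition convex_rate :: "model \<Rightarrow> (int \<Rightarrow> real) \<Rightarrow> bool" where
  "convex_rate m f \<longleftrightarrow>
     (\<forall>z. z - 1 \<in> state_space m \<and> z \<in> state_space m \<and> z + 1 \<in> state_space m \<longrightarrow>
        f (z + 1) - f z \<ge> f z - f (z - 1))"

definition rate_fact :: "(int \<Rightarrow> real) \<Rightarrow> int \<Rightarrow> real" where
  "rate_fact f z =
     (if z > 0 then \<Prod>y\<in>{1..z}. f y
      else if z = 0 then 1
      else 1 / (\<Prod>y\<in>{z + 1..0}. f y))"

text \<open>
  The limits are taken in the extended reals, where they exist by monotonicity of \<open>f\<close>.
\<close>

definition theta_upper :: "(int \<Rightarrow> real) \<Rightarrow> ereal" where
  "theta_upper f = lim (\<lambda>n::nat. ereal (ln (f (int n))))"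

fun theta_lower :: "model \<Rightarrow> (int \<Rightarrow> real) \<Rightarrow> ereal" where
  "theta_lower ZR f = -\<infinity>"
| "theta_lower BL f = lim (\<lambda>n::nat. ereal (ln (f (- int n))))"

definition theta_range :: "model \<Rightarrow> (int \<Rightarrow> real) \<Rightarrow> real set" where
  "theta_range m f = {\<theta>. theta_lower m f < ereal \<theta> \<and> ereal \<theta> < theta_upper f}"

definition partition_fun :: "model \<Rightarrow> (int \<Rightarrow> real) \<Rightarrow> real \<Rightarrow> real" where
  "partition_fun m f \<theta> = (\<Sum>\<^sub>\<infinity>z\<in>state_space m. exp (\<theta> * real_of_int z) / rate_fact f z)"

definition mu :: "model \<Rightarrow> (int \<Rightarrow> real) \<Rightarrow> real \<Rightarrow> int measure" where
  "mu m f \<theta> = point_measure (state_space m)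
     (\<lambda>z. ennreal (1 / partition_fun m f \<theta> * (exp (\<theta> * real_of_int z) / rate_fact f z)))"

definition stationary_measure :: "model \<Rightarrow> (int \<Rightarrow> real) \<Rightarrow> real \<Rightarrow> (int \<Rightarrow> int) measure" where
  "stationary_measure m f \<theta> = PiM (UNIV :: int set) (\<lambda>_. mu m f \<theta>)"

definition mean_density :: "model \<Rightarrow> (int \<Rightarrow> real) \<Rightarrow> real \<Rightarrow> real" where
  "mean_density m f \<theta> = (LINT \<omega>|stationary_measure m f \<theta>. real_of_int (\<omega> 0))"

definition density_range :: "model \<Rightarrow> (int \<Rightarrow> real) \<Rightarrow> real set" where
  "density_range m f = mean_density m f ` theta_range m f"

definition theta_of_density :: "model \<Rightarrow> (int \<Rightarrow> real) \<Rightarrow> real \<Rightarrow> real" where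
  "theta_of_density m f = inv_into (theta_range m f) (mean_density m f)"

text \<open>The hydrodynamic flux; meaningful for arguments in \<open>density_range m f\<close>.\<close>

definition flux :: "model \<Rightarrow> (int \<Rightarrow> real) \<Rightarrow> real \<Rightarrow> real" where
  "flux m f \<rho> =
     (LINT \<omega>|stationary_measure m f (theta_of_density m f \<rho>). jump_rate m f (\<omega> 0) (\<omega> 1))"

text \<open>As for \<^const>\<open>convex_on\<close>, convexity of the domain is part of the definition.\<close>

definition strictly_convex_on :: "real set \<Rightarrow> (real \<Rightarrow> real) \<Rightarrow> bool" where
  "strictly_convex_on S g \<longleftrightarrow> convex S \<and>
     (\<forall>x\<in>S. \<forall>y\<in>S. \<forall>u v. x \<noteq> y \<and> 0 < u \<and> 0 < v \<and> u + v = 1 \<longrightarrow>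
        g (u * x + v * y) < u * g x + v * g y)"

text \<open>
  Linearity is meant in the homogeneous sense. For the rate function of the zero range process
  this agrees with affinity because \<open>f 0 = 0\<close>; for the flux it is the stronger reading.
\<close>

definition linear_rate :: "(int \<Rightarrow> real) \<Rightarrow> bool" where
  "linear_rate f \<longleftrightarrow> (\<exists>c. \<forall>z\<ge>0. f z = c * real_of_int z)"

definition linear_flux :: "model \<Rightarrow> (int \<Rightarrow> real) \<Rightarrow> bool" where
  "linear_flux m f \<longleftrightarrow> (\<exists>c. \<forall>\<rho>\<in>density_range m f. flux m f \<rho> = c * \<rho>)"

end

theory Submission
  imports Defs
begin

text \<open>
  Convexity makes \<open>f\<close> grow at least linearly, so every real \<open>\<theta>\<close> is admissible. No derivative of the
  flux is needed. Suppose \<open>\<rho>(\<theta>) = u \<rho>(\<theta>\<^sub>1) + v \<rho>(\<theta>\<^sub>2)\<close> is a proper convex combination, and write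
  \<open>\<mu>, \<mu>\<^sub>1, \<mu>\<^sub>2\<close> for the three one-site marginals. The relative density
  \<open>g = (u \<mu>\<^sub>1 + v \<mu>\<^sub>2) / \<mu> - 1\<close> is a sum of exponentials up to a constant, hence strictly convex in \<open>z\<close>,
  and under \<open>\<mu>\<close> it is orthogonal to \<open>1\<close> and to \<open>z\<close>. So its sign pattern is \<open>+ - +\<close>.
  For convex \<open>F\<close>, let \<open>l\<close> be the chord of \<open>F\<close> through the two sign changes of \<open>g\<close>: then
  \<open>g (F - l) \<ge> 0\<close> pointwise, whence \<open>E(g F) = E(g (F - l)) \<ge> 0\<close>, with equality only if \<open>F\<close> is affine.
  The flux is the case \<open>F z = f z\<close> for the zero range process and, because the rate is a sum of
  functions of single sites, \<open>F z = f z + f (- z)\<close> for the bricklayers' model; the latter is never affine.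
\<close>

section \<open>Convex sequences on an up-closed set of integers\<close>

locale int_ray =
  fixes I :: "int set"
  assumes nonempty: "I \<noteq> {}"
    and upward: "y \<in> I \<Longrightarrow> y \<le> z \<Longrightarrow> z \<in> I"
begin

text \<open>The condition is anchored at the leftmost of three points: up-closedness puts the other
  two into \<open>I\<close>, so one formula serves for both state spaces.\<close>

definition convex_seq :: "(int \<Rightarrow> real) \<Rightarrow> bool" where
  "convex_seq F \<longleftrightarrow> (\<forall>z\<in>I. F (z + 1) - F z \<le> F (z + 2) - F (z + 1))"

definition strictly_convex_seq :: "(int \<Rightarrow> real) \<Rightarrow> bool" where
  "strictly_convex_seq F \<longleftrightarrow> (\<forall>z\<in>I. F (z + 1) - F z < F (z + 2) - F (z + 1))"

lemma strictly_convex_seq_imp_convex_seq: "strictly_convex_seq F \<Longrightarrow> convex_seq F"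
  by (force simp: convex_seq_def strictly_convex_seq_def)

lemma convex_seq_increment_mono:
  assumes "convex_seq F" "x \<in> I" "x \<le> y"
  shows "F (x + 1) - F x \<le> F (y + 1) - F y"
  using assms(3)
proof (induction rule: int_ge_induct)
  case (step y)
  then have "y \<in> I" using assms(2) upward by blast
  then have "F (y + 1) - F y \<le> F (y + 2) - F (y + 1)"
    using assms(1) by (auto simp: convex_seq_def)
  with step show ?case by (simp add: add.assoc)
qed simp

lemma convex_seq_tangent_right:
  assumes "convex_seq F" "b \<in> I" "b \<le> c"
  shows "F b + real_of_int (c - b) * (F (b + 1) - F b) \<le> F c"
  using assms(3)
proof (induction rule: int_ge_induct)
  case (step c)
  with convex_seq_increment_mono[OF assms(1,2), of c] show ?case
    by (simp add: algebra_simps)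
qed simp

lemma convex_seq_tangent_left:
  assumes "convex_seq F" "a \<in> I" "a \<le> b"
  shows "F b - real_of_int (b - a) * (F (b + 1) - F b) \<le> F a"
  using assms(3,2)
proof (induction rule: int_le_induct)
  case (step a)
  then have "a \<in> I" using upward[of "a - 1" a] by simp
  with step convex_seq_increment_mono[OF assms(1), of "a - 1" b] show ?case
    by (simp add: algebra_simps)
qed simp

text \<open>The line through \<open>b\<close> with slope \<open>F (b + 1) - F b\<close> lies below
  \<open>F\<close> at both \<open>a\<close> and \<open>c\<close>; weighting the two bounds by the
  distances cancels the slope. Clearing denominators admits \<open>a = b\<close> and
  \<open>b = c\<close>.\<close>

lemma convex_seq_chord:
  assumes "convex_seq F" "a \<in> I" "a \<le> b" "b \<le> c"
  shows "real_of_int (c - a) * F b \<le> real_of_int (c - b) * F a + real_of_int (b - a) * F c"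
proof -
  have "b \<in> I" using assms(2,3) upward by blast
  let ?s = "F (b + 1) - F b"
  have "real_of_int (b - a) * (F b + real_of_int (c - b) * ?s) \<le> real_of_int (b - a) * F c"
    using convex_seq_tangent_right[OF assms(1) \<open>b \<in> I\<close> assms(4)] assms(3)
    by (intro mult_left_mono) auto
  moreover have "real_of_int (c - b) * (F b - real_of_int (b - a) * ?s) \<le> real_of_int (c - b) * F a"
    using convex_seq_tangent_left[OF assms(1-3)] assms(4)
    by (intro mult_left_mono) auto
  ultimately show ?thesis by (simp add: algebra_simps)
qed

lemma strictly_convex_seq_chord:
  assumes "strictly_convex_seq F" "a \<in> I" "a < b" "b < c"
  shows "real_of_int (c - a) * F b < real_of_int (c - b) * F a + real_of_int (b - a) * F c"
proof -
  have cx: "convex_seq F" using assms(1) by (rule strictly_convex_seq_imp_convex_seq)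
  have bI: "b - 1 \<in> I" "b \<in> I" using assms(2,3) upward[of a] by auto
  let ?s = "F (b + 1) - F b" and ?s' = "F b - F (b - 1)"
  have "?s' < ?s" using assms(1)[unfolded strictly_convex_seq_def, rule_format, OF bI(1)] by (simp add: add.commute)
  have "real_of_int (b - a) * (F b + real_of_int (c - b) * ?s) \<le> real_of_int (b - a) * F c"
    using convex_seq_tangent_right[OF cx bI(2), of c] assms(3,4)
    by (intro mult_left_mono) auto
  \<comment> \<open>To the left of \<open>b\<close> the smaller slope \<open>?s'\<close> is used;
    the gap \<open>?s' < ?s\<close>, multiplied by \<open>b - a > 0\<close>, makes the chord
    inequality strict.\<close>
  moreover have "F b - real_of_int (b - a) * ?s' \<le> F a"
    using convex_seq_tangent_left[OF cx assms(2), of "b - 1"] assms(3)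
    by (simp add: algebra_simps)
  moreover have "real_of_int (b - a) * ?s' < real_of_int (b - a) * ?s"
    using \<open>?s' < ?s\<close> assms(3) by simp
  ultimately have "real_of_int (c - b) * (F b - real_of_int (b - a) * ?s) < real_of_int (c - b) * F a"
    using assms(4) by (intro mult_strict_left_mono) auto
  with \<open>real_of_int (b - a) * (F b + _) \<le> _\<close> show ?thesis by (simp add: algebra_simps)
qed

lemma strictly_convex_seq_neg_between:
  assumes "strictly_convex_seq F" "a \<in> I" "a < b" "b < c" "F a \<le> 0" "F c \<le> 0"
  shows "F b < 0"
proof -
  have "real_of_int (c - b) * F a + real_of_int (b - a) * F c \<le> 0"
    using assms by (intro add_nonpos_nonpos mult_nonneg_nonpos) auto
  with strictly_convex_seq_chord[OF assms(1-4)] have "real_of_int (c - a) * F b < 0" by linarith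
  then show ?thesis using assms(3,4) by (simp add: mult_less_0_iff)
qed

text \<open>
  Multiplying by suitable affine functions excludes every sign pattern of \<open>g\<close> other than \<open>+ - +\<close>.
\<close>

lemma no_affine_multiplier:
  assumes g: "strictly_convex_seq g" and w: "\<And>z. z \<in> I \<Longrightarrow> w z > 0"
    and sum0: "((\<lambda>z. w z * g z) has_sum 0) I"
    and sum1: "((\<lambda>z. w z * g z * real_of_int z) has_sum 0) I"
    and AB: "A \<noteq> 0 \<or> B \<noteq> 0"
  obtains z where "z \<in> I" "g z * (A * real_of_int z + B) < 0"
proof (rule ccontr)
  let ?l = "\<lambda>z. A * real_of_int z + B"
  assume "\<not> thesis"
  then have nonneg: "g z * ?l z \<ge> 0" if "z \<in> I" for z
    using that \<open>z \<in> I \<Longrightarrow> g z * (A * z + B) < 0 \<Longrightarrow> thesis\<close> by force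
  have hs: "((\<lambda>z. w z * (g z * ?l z)) has_sum 0) I"
    using has_sum_add[OF has_sum_cmult_right[OF sum1, of A] has_sum_cmult_right[OF sum0, of B]]
    by (simp add: algebra_simps)
  have "w z * (g z * ?l z) = 0" if "z \<in> I" for z
    using nonneg_has_sum_le_0D[OF hs, of z] w nonneg that by (simp add: less_imp_le)
  then have zero: "g z = 0 \<or> ?l z = 0" if "z \<in> I" for z
    using w that by fastforce
  obtain i where "i \<in> I" using nonempty by auto
  \<comment> \<open>A nonzero affine function has at most one zero. From some \<open>p\<close> on it
    is therefore \<open>g\<close> that vanishes, against strict convexity.\<close>
  obtain p where p: "p \<in> I" "\<And>z. z \<ge> p \<Longrightarrow> ?l z \<noteq> 0"
  proof (cases "\<exists>r\<ge>i. ?l r = 0")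
    case True
    then obtain r where r: "r \<ge> i" "?l r = 0" by auto
    have "?l z \<noteq> 0" if "z \<ge> r + 1" for z
    proof
      assume "?l z = 0"
      then have "A * (real_of_int z - real_of_int r) = 0"
        using r(2) unfolding right_diff_distrib by linarith
      moreover have "real_of_int z - real_of_int r \<noteq> 0" using that by simp
      ultimately show False using AB r(2) by simp
    qed
    then show ?thesis using that[of "r + 1"] upward[OF \<open>i \<in> I\<close>] r(1) by auto
  qed (use \<open>i \<in> I\<close> that in auto)
  have "g z = 0" if "z \<ge> p" for z using zero[of z] p that upward[OF p(1)] by auto
  then show False using g p(1) by (auto simp: strictly_convex_seq_def)
qed

lemma sign_pattern:
  assumes g: "strictly_convex_seq g" and w: "\<And>z. z \<in> I \<Longrightarrow> w z > 0"
    and sum0: "((\<lambda>z. w z * g z) has_sum 0) I"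
    and sum1: "((\<lambda>z. w z * g z * real_of_int z) has_sum 0) I"
  obtains p q where "p \<in> I" "p \<le> q" "g p \<le> 0" "g q \<le> 0" "p = q \<Longrightarrow> g p < 0"
    "\<And>z. p < z \<Longrightarrow> z < q \<Longrightarrow> g z < 0"
    "\<And>z. z \<in> I \<Longrightarrow> z < p \<Longrightarrow> g z > 0" "\<And>z. q < z \<Longrightarrow> g z > 0"
proof -
  note nam = no_affine_multiplier[OF g w sum0 sum1]
  note neg = strictly_convex_seq_neg_between[OF g]
  \<comment> \<open>The constant multipliers 1 and -1 show that \<open>g\<close> takes both
    signs.\<close>
  obtain m where m: "m \<in> I" "g m < 0" using nam[of 0 1] by auto
  obtain k where k: "k \<in> I" "g k > 0" using nam[of 0 "-1"] by auto
  \<comment> \<open>Otherwise there is a last point \<open>p\<close> with \<open>g p > 0\<close>.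
    The multiplier \<open>p - z\<close> then yields a negative value of \<open>g\<close> to the left
    of \<open>p\<close>, which together with \<open>g m < 0\<close> forces
    \<open>g p < 0\<close>.\<close>
  have "\<exists>b. m < b \<and> g b > 0"
  proof (rule ccontr)
    assume "\<not> ?thesis"
    then have np: "g z \<le> 0" if "m \<le> z" for z using that m(2) by (cases "z = m") (force simp: not_less)+
    define p where "p = Max {z \<in> {k..m}. g z > 0}"
    have fin: "finite {z \<in> {k..m}. g z > 0}" by (rule finite_subset[of _ "{k..m}"]) auto
    have km: "k \<le> m" using np[of k] k by (cases "k \<le> m") auto
    have "p \<in> {z \<in> {k..m}. g z > 0}"
      unfolding p_def using fin by (rule Max_in) (use k km in auto)
    then have p: "k \<le> p" "p \<le> m" "g p > 0" by auto
    have np': "g z \<le> 0" if "p < z" for z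
    proof (rule ccontr)
      assume "\<not> g z \<le> 0"
      then have "z < m" using np[of z] by (cases "m \<le> z") auto
      then have "z \<le> p" unfolding p_def using fin p(1) that \<open>\<not> g z \<le> 0\<close> by (intro Max_ge) auto
      then show False using that by simp
    qed
    obtain z where z: "z \<in> I" "g z * (p - real_of_int z) < 0"
      using nam[of "-1" "real_of_int p"] by auto
    then consider "z < p" "g z < 0" | "p < z" "g z > 0"
      by (cases z p rule: linorder_cases) (auto simp: mult_less_0_iff)
    then show False
    proof cases
      case 1
      then show False using neg[OF z(1), of p m] p m by (cases "p = m") auto
    qed (use np'[of z] in auto)
  qed
  then obtain b where b: "m < b" "g b > 0" by auto
  \<comment> \<open>Mirror image: \<open>p\<close> is now the first point with
    \<open>g p > 0\<close>, and the multiplier is \<open>z - p\<close>.\<close>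
  have "\<exists>a\<in>I. a < m \<and> g a > 0"
  proof (rule ccontr)
    assume "\<not> ?thesis"
    then have np: "g z \<le> 0" if "z \<in> I" "z \<le> m" for z using that m(2) by (cases "z = m") (force simp: not_less)+
    define p where "p = Min {z \<in> {m..b}. g z > 0}"
    have fin: "finite {z \<in> {m..b}. g z > 0}" by (rule finite_subset[of _ "{m..b}"]) auto
    have "p \<in> {z \<in> {m..b}. g z > 0}"
      unfolding p_def using fin by (rule Min_in) (use b in auto)
    then have p: "m \<le> p" "p \<le> b" "g p > 0" by auto
    have np': "g z \<le> 0" if "z \<in> I" "z < p" for z
    proof (rule ccontr)
      assume "\<not> g z \<le> 0"
      then have "m < z" using np[OF that(1)] by (cases "z \<le> m") auto
      then have "p \<le> z" unfolding p_def using fin p(2) that \<open>\<not> g z \<le> 0\<close> by (intro Min_le) auto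
      then show False using that by simp
    qed
    obtain z where z: "z \<in> I" "g z * (real_of_int z - p) < 0"
      using nam[of 1 "- real_of_int p"] by auto
    then consider "p < z" "g z < 0" | "z < p" "g z > 0"
      by (cases z p rule: linorder_cases) (auto simp: mult_less_0_iff)
    then show False
    proof cases
      case 1
      then show False using neg[OF m(1), of p z] p m by (cases "p = m") auto
    qed (use np'[OF z(1)] in auto)
  qed
  then obtain a where a: "a \<in> I" "a < m" "g a > 0" by auto
  \<comment> \<open>Restricting to \<open>{a..b}\<close> gives a finite set with a minimum and a
    maximum. A nonpositive value of \<open>g\<close> outside would, together with
    \<open>g m < 0\<close>, force \<open>g a < 0\<close> or \<open>g b < 0\<close>.\<close>
  define N where "N = {z \<in> {a..b}. g z \<le> 0}"
  have fin: "finite N" unfolding N_def by (rule finite_subset[of _ "{a..b}"]) auto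
  have mN: "m \<in> N" using a b m by (auto simp: N_def)
  define p where "p = Min N"
  define q where "q = Max N"
  have "N \<noteq> {}" using mN by blast
  have "p \<in> N" unfolding p_def using fin \<open>N \<noteq> {}\<close> by (rule Min_in)
  moreover have "q \<in> N" unfolding q_def using fin \<open>N \<noteq> {}\<close> by (rule Max_in)
  ultimately have pq: "a \<le> p" "g p \<le> 0" "q \<le> b" "g q \<le> 0" by (auto simp: N_def)
  have pm: "p \<le> m" "m \<le> q" using fin mN by (auto simp: p_def q_def)
  have pI: "p \<in> I" using upward[OF a(1) pq(1)] .
  show thesis
  proof (rule that[of p q])
    show "p = q \<Longrightarrow> g p < 0" using pm m by (cases "p = m") auto
    show "g z < 0" if "p < z" "z < q" for z using neg[OF pI that pq(2,4)] .
    show "g z > 0" if "z \<in> I" "z < p" for z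
    proof (rule ccontr)
      assume *: "\<not> g z > 0"
      show False
      proof (cases "z < a")
        case True
        then show False using neg[of z a m] that * a m by auto
      next
        case False
        then have "z \<in> N" using * that pm a b by (auto simp: N_def)
        then show False using that(2) Min_le[OF fin] by (force simp: p_def)
      qed
    qed
    show "g z > 0" if "q < z" for z
    proof (rule ccontr)
      assume *: "\<not> g z > 0"
      show False
      proof (cases "b < z")
        case True
        then show False using neg[of m b z] that * b m by auto
      next
        case False
        then have "z \<in> N" using * that pm a b by (auto simp: N_def)
        then show False using that Max_ge[OF fin] by (force simp: q_def)
      qed
    qed
  qed (use pI pm pq in auto)
qed

proposition convex_covariance:
  assumes g: "strictly_convex_seq g" and F: "convex_seq F"
    and w: "\<And>z. z \<in> I \<Longrightarrow> w z > 0"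
    and sum0: "((\<lambda>z. w z * g z) has_sum 0) I"
    and sum1: "((\<lambda>z. w z * g z * real_of_int z) has_sum 0) I"
    and sumF: "((\<lambda>z. w z * g z * F z) has_sum S) I"
    and F_not_affine: "\<And>A B. \<exists>z\<in>I. F z \<noteq> A * real_of_int z + B"
  shows "S > 0"
proof (rule ccontr)
  assume "\<not> S > 0"
  obtain p q where pq: "p \<in> I" "p \<le> q" "g p \<le> 0" "g q \<le> 0" "p = q \<Longrightarrow> g p < 0"
    and mid: "\<And>z. p < z \<Longrightarrow> z < q \<Longrightarrow> g z < 0"
    and left: "\<And>z. z \<in> I \<Longrightarrow> z < p \<Longrightarrow> g z > 0" and right: "\<And>z. q < z \<Longrightarrow> g z > 0"
    using sign_pattern[OF g w sum0 sum1] by metis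
  define s where "s = (if p < q then (F q - F p) / (q - p) else F (p + 1) - F p)"
  define l where "l z = F p + s * (real_of_int z - p)" for z
  \<comment> \<open>If \<open>p = q\<close>, any supporting line of \<open>F\<close> at \<open>p\<close> serves as the chord.\<close>
  have lp: "l p = F p" by (simp add: l_def)
  have lq: "l q = F q" using pq(2) by (auto simp: l_def s_def)
  have l_affine: "real_of_int (q - p) * l z =
      real_of_int (q - z) * F p + real_of_int (z - p) * F q" if "p < q" for z
    using that by (simp add: l_def s_def field_simps)
  have F_above_left: "l z \<le> F z" if "z \<in> I" "z < p" for z
  proof (cases "p < q")
    case True
    have "real_of_int (q - p) * l z \<le> real_of_int (q - p) * F z"
      using convex_seq_chord[OF F that(1), of p q] that(2) pq(2) l_affine[OF True, of z]
      by (simp add: algebra_simps)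
    then show ?thesis using True by (simp add: mult_le_cancel_left)
  next
    case False
    then show ?thesis
      using convex_seq_tangent_left[OF F that(1), of p] that(2) by (simp add: l_def s_def algebra_simps)
  qed
  have F_above_right: "l z \<le> F z" if "q < z" for z
  proof (cases "p < q")
    case True
    have "real_of_int (q - p) * l z \<le> real_of_int (q - p) * F z"
      using convex_seq_chord[OF F pq(1,2), of z] that l_affine[OF True, of z]
      by (simp add: algebra_simps)
    then show ?thesis using True by (simp add: mult_le_cancel_left)
  next
    case False
    then have "p = q" using pq by auto
    then show ?thesis
      using convex_seq_tangent_right[OF F pq(1), of z] that by (simp add: l_def s_def algebra_simps)
  qed
  have F_below: "F z \<le> l z" if "p < z" "z < q" for z
  proof -
    have "real_of_int (q - p) * F z \<le> real_of_int (q - p) * l z"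
      using convex_seq_chord[OF F pq(1), of z q] that l_affine[of z] by simp
    then show ?thesis using that by (simp add: mult_le_cancel_left)
  qed
  \<comment> \<open>Zeros of \<open>g\<close> can only sit at \<open>p\<close> and \<open>q\<close>,
    where \<open>l\<close> meets \<open>F\<close>. So a vanishing product always yields
    \<open>F z = l z\<close>, which is what turns equality into affinity of
    \<open>F\<close>.\<close>
  have nonneg: "g z * (F z - l z) \<ge> 0" and zeroD: "g z * (F z - l z) = 0 \<Longrightarrow> F z = l z"
    if "z \<in> I" for z
  proof -
    consider "z < p" | "z = p" | "p < z" "z < q" | "z = q" | "q < z" by linarith
    then have "g z * (F z - l z) \<ge> 0 \<and> (g z * (F z - l z) = 0 \<longrightarrow> F z = l z)"
    proof cases
      case 1
      then show ?thesis using left[OF that] F_above_left[OF that] by (auto intro!: mult_nonneg_nonneg)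
    next
      case 3
      then show ?thesis using mid[of z] F_below[of z] by (auto intro!: mult_nonpos_nonpos)
    next
      case 5
      then show ?thesis using right[of z] F_above_right[of z] by (auto intro!: mult_nonneg_nonneg)
    qed (auto simp: lp lq)
    then show "g z * (F z - l z) \<ge> 0" "g z * (F z - l z) = 0 \<Longrightarrow> F z = l z" by auto
  qed
  have l_eq: "l z = s * real_of_int z + (F p - s * p)" for z by (simp add: l_def algebra_simps)
  \<comment> \<open>By \<open>sum0\<close> and \<open>sum1\<close>, subtracting the affine
    \<open>l\<close> leaves the sum \<open>S\<close> unchanged.\<close>
  have hs: "((\<lambda>z. w z * (g z * (F z - l z))) has_sum S) I"
    using has_sum_add[OF sumF has_sum_add[OF has_sum_cmult_right[OF sum1, of "- s"]
        has_sum_cmult_right[OF sum0, of "s * p - F p"]]]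
    by (simp add: l_eq algebra_simps)
  have "F z = l z" if "z \<in> I" for z
  proof -
    have "w z * (g z * (F z - l z)) = 0"
      using nonneg_has_sum_le_0D[OF hs _ _ that] \<open>\<not> S > 0\<close> w nonneg by (simp add: less_imp_le)
    then show ?thesis using w[OF that] zeroD[OF that] by auto
  qed
  then show False using F_not_affine[of s "F p - s * p"] l_eq by auto
qed

end

section \<open>Second differences of exponentials; integrals over count spaces as sums\<close>

lemma strict_convex_exp_increment:
  fixes \<alpha> t :: real
  assumes "\<alpha> \<noteq> 0"
  shows "exp (\<alpha> * (t + 1)) - exp (\<alpha> * t) < exp (\<alpha> * (t + 2)) - exp (\<alpha> * (t + 1))"
proof -
  have "exp (\<alpha> * (t + 1)) = exp (\<alpha> * t) * exp \<alpha>"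
    by (simp add: distrib_left exp_add)
  moreover have "exp (\<alpha> * (t + 2)) = exp (\<alpha> * t) * (exp \<alpha> * exp \<alpha>)"
    by (simp add: distrib_left flip: exp_add)
  \<comment> \<open>This product is the second difference itself; it is positive because
    \<open>exp \<alpha> \<noteq> 1\<close>.\<close>
  moreover have "0 < exp (\<alpha> * t) * ((exp \<alpha> - 1) * (exp \<alpha> - 1))"
    using assms by (simp flip: power2_eq_square)
  ultimately show ?thesis by (simp add: algebra_simps)
qed

lemma convex_exp_increment:
  fixes \<alpha> t :: real
  shows "exp (\<alpha> * (t + 1)) - exp (\<alpha> * t) \<le> exp (\<alpha> * (t + 2)) - exp (\<alpha> * (t + 1))"
  using strict_convex_exp_increment[of \<alpha> t] by (cases "\<alpha> = 0") auto

lemma integrable_count_space_iff: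
  fixes F :: "int \<Rightarrow> real"
  shows "integrable (count_space A) F \<longleftrightarrow> F summable_on A"
  by (simp only: summable_on_iff_abs_summable_on_real[of F] abs_summable_equivalent
      Infinite_Set_Sum.abs_summable_on_def)

lemma integral_count_space_eq:
  fixes F :: "int \<Rightarrow> real"
  assumes "F summable_on A"
  shows "(LINT z|count_space A. F z) = infsum F A"
proof -
  have "Infinite_Set_Sum.abs_summable_on F A"
    using assms integrable_count_space_iff Infinite_Set_Sum.abs_summable_on_def by blast
  then show ?thesis using infsetsum_infsum by (metis infsetsum_def)
qed

section \<open>Growth of the rate function and the admissible parameters\<close>

locale convex_model =
  fixes m :: model and f :: "int \<Rightarrow> real"
  assumes rate: "is_rate_function m f"
    and nondegenerate: "theta_lower m f < theta_upper f"
    and convex: "convex_rate m f"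
begin

lemma state_space_upward: "y \<in> state_space m \<Longrightarrow> y \<le> z \<Longrightarrow> z \<in> state_space m"
  by (cases m) auto

lemma zero_in_state_space [simp]: "0 \<in> state_space m"
  by (cases m) auto

sublocale int_ray "state_space m"
  by unfold_locales (use zero_in_state_space state_space_upward in blast)+

lemma nonneg_in_state_space: "0 \<le> z \<Longrightarrow> z \<in> state_space m"
  by (cases m) auto

lemma convex_seq_f: "convex_seq f"
  unfolding convex_seq_def
proof
  fix z assume "z \<in> state_space m"
  then have "z + 1 \<in> state_space m" "z + 1 + 1 \<in> state_space m"
    using state_space_upward by (auto elim!: state_space_upward)
  with \<open>z \<in> state_space m\<close> convex[unfolded convex_rate_def, rule_format, of "z + 1"]
  show "f (z + 1) - f z \<le> f (z + 2) - f (z + 1)" by (simp add: add.assoc)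
qed

text \<open>The shift by one excludes the point 0 of the zero range process, where \<open>f\<close>
  vanishes.\<close>

lemma f_pos: "z \<in> state_space m \<Longrightarrow> f (z + 1) > 0"
  using rate by (cases m) auto

text \<open>Nondegeneracy enters here: a constant \<open>f\<close> in the bricklayers' model would
  make both parameter bounds equal. For \<open>ZR\<close>, \<open>f 0 = 0 < f 1\<close>.\<close>

lemma f_increases: "\<exists>z\<in>state_space m. f z < f (z + 1)"
proof (cases m)
  case ZR
  then show ?thesis using rate by (intro bexI[of _ 0]) auto
next
  case BL
  show ?thesis
  proof (rule ccontr)
    assume "\<not> ?thesis"
    moreover have "mono f" using rate BL by simp
    ultimately have step: "f (z + 1) = f z" for z
      using monoD[OF \<open>mono f\<close>, of z "z + 1"] BL by (auto simp: not_less intro: antisym)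
    have const: "f z = f 0" for z
    proof (induction z rule: int_induct[where k = 0])
      case (step2 i)
      then show ?case using step[of "i - 1"] by simp
    qed (auto simp: step)
    have "theta_lower m f = theta_upper f"
      unfolding BL theta_lower.simps theta_upper_def
      by (subst (1 2) const) simp
    then show False using nondegenerate by simp
  qed
qed

text \<open>By convexity a single positive increment \<open>d\<close> at \<open>z\<close> bounds all
  later increments from below, so \<open>f n \<ge> f z + (n - z) * d\<close>. The threshold
  \<open>N\<close> solves this bound for \<open>C\<close>.\<close>

lemma f_at_top: "filterlim (\<lambda>n. f (int n)) at_top sequentially"
  unfolding filterlim_at_top
proof
  fix C :: real
  obtain z where z: "z \<in> state_space m" "f z < f (z + 1)" using f_increases by auto
  define d where "d = f (z + 1) - f z"
  have "d > 0" using z by (simp add: d_def)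
  obtain N :: nat where N: "real N > max z ((C - f z) / d + z)" using reals_Archimedean2 by blast
  show "\<forall>\<^sub>F n in sequentially. C \<le> f (int n)"
  proof (rule eventually_sequentiallyI)
    fix n assume "N \<le> n"
    then have n: "real n > z" "real n > (C - f z) / d + z" using N by linarith+
    then have "(C - f z) / d < real n - z" by linarith
    then have "C - f z \<le> (real n - z) * d" using \<open>d > 0\<close> by (simp add: pos_divide_less_eq)
    also have "f z + (real n - z) * d \<le> f (int n)"
      using convex_seq_tangent_right[OF convex_seq_f z(1), of "int n"] n(1) by (simp add: d_def)
    finally show "C \<le> f (int n)" by simp
  qed
qed

text \<open>Unboundedness of \<open>f\<close> sends the upper limit to infinity; for
  \<open>BL\<close> the relation \<open>f z * f (1 - z) = 1\<close> mirrors this, shifted by one, at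
  the lower end. Hence later statements put no restriction on \<theta>.\<close>

lemma theta_range_UNIV: "theta_range m f = UNIV"
proof -
  have lim: "filterlim (\<lambda>n. ln (f (int n))) at_top sequentially"
    using filterlim_compose[OF ln_at_top f_at_top] .
  have up: "theta_upper f = \<infinity>"
    unfolding theta_upper_def by (intro limI) (use lim in \<open>simp add: tendsto_PInfty_eq_at_top\<close>)
  have "theta_lower m f = -\<infinity>"
  proof (cases m)
    case BL
    have neg: "ln (f (- int n)) = - ln (f (int (Suc n)))" for n
    proof -
      have "f (- int n) * f (int (Suc n)) = 1" "f (- int n) > 0" "f (int (Suc n)) > 0"
        using rate BL by (auto simp: algebra_simps dest: spec[of _ "- int n"])
      then have "f (- int n) = inverse (f (int (Suc n)))" by (simp add: field_simps)
      then show ?thesis using \<open>f (int (Suc n)) > 0\<close> by (simp add: ln_inverse)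
    qed
    have "(\<lambda>n. ereal (ln (f (int (Suc n))))) \<longlonglongrightarrow> \<infinity>"
      using lim filterlim_sequentially_Suc[of "\<lambda>n. ln (f (int n))"] by (simp add: tendsto_PInfty_eq_at_top)
    from tendsto_uminus_ereal[OF this]
    have "(\<lambda>n. ereal (ln (f (- int n)))) \<longlonglongrightarrow> -\<infinity>" by (simp add: neg)
    then show ?thesis using BL by (simp add: limI)
  qed simp
  with up show ?thesis by (simp add: theta_range_def)
qed

section \<open>The generalised factorial, the weights and their summability\<close>

lemma rate_fact_Suc: "z \<in> state_space m \<Longrightarrow> rate_fact f (z + 1) = rate_fact f z * f (z + 1)"
proof -
  assume z: "z \<in> state_space m"
  consider "z \<ge> 0" | "z = -1" | "z < -1" by linarith
  then show ?thesis
  proof cases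
    case 1
    then have "{1..z + 1} = insert (z + 1) {1..z}" by auto
    then show ?thesis using 1 by (cases "z = 0") (simp_all add: rate_fact_def)
  next
    \<comment> \<open>At the junction of the branches, \<open>rate_fact f (-1)\<close> is
      \<open>1 / f 0\<close> and \<open>rate_fact f 0\<close> is 1.\<close>
    case 2
    then have "f 0 > 0" using f_pos[OF z] by simp
    then show ?thesis using 2 by (simp add: rate_fact_def)
  next
    case 3
    then have "{z + 1..0} = insert (z + 1) {z + 1 + 1..0}" by auto
    then show ?thesis using 3 f_pos[OF z] by (simp add: rate_fact_def)
  qed
qed

lemma rate_fact_pos: "z \<in> state_space m \<Longrightarrow> rate_fact f z > 0"
proof -
  assume z: "z \<in> state_space m"
  have "f y > 0" if "y \<in> {z + 1..0}" for y
    using f_pos[of "y - 1"] state_space_upward[OF z, of "y - 1"] that by auto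
  moreover have "f y > 0" if "y \<in> {1..z}" for y
    using f_pos[of "y - 1"] nonneg_in_state_space[of "y - 1"] that by auto
  ultimately show ?thesis by (auto simp: rate_fact_def intro!: prod_pos)
qed

text \<open>Stepping outwards from \<open>z\<close> multiplies the factorial by
  \<open>f (z + 1)\<close>, stepping outwards from \<open>- z\<close> divides it by
  \<open>f (- z)\<close>; these factors agree because
  \<open>f (- z) * f (z + 1) = 1\<close>.\<close>

lemma rate_fact_uminus:
  assumes "m = BL"
  shows "rate_fact f (- z) = rate_fact f z"
proof -
  have nonneg: "rate_fact f (- z) = rate_fact f z" if "0 \<le> z" for z
    using that
  proof (induction rule: int_ge_induct)
    case (step z)
    have inv: "f (- z) * f (z + 1) = 1"
      using rate assms by (auto simp: algebra_simps dest: spec[of _ "- z"])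
    have "rate_fact f (z + 1) = rate_fact f (- (z + 1) + 1) * f (z + 1)"
      using rate_fact_Suc[of z] step assms by simp
    also have "\<dots> = rate_fact f (- (z + 1)) * (f (- z) * f (z + 1))"
      using rate_fact_Suc[of "- (z + 1)"] assms by (simp add: algebra_simps)
    finally show ?case using inv by simp
  qed simp
  show ?thesis using nonneg[of z] nonneg[of "- z"] by (cases "0 \<le> z") auto
qed

definition weight :: "real \<Rightarrow> int \<Rightarrow> real" where
  "weight \<theta> z = exp (\<theta> * real_of_int z) / rate_fact f z"

lemma weight_pos: "z \<in> state_space m \<Longrightarrow> weight \<theta> z > 0"
  by (simp add: weight_def rate_fact_pos)

text \<open>A factor \<open>f\<close> is traded for a shift by one. This gives both the ratio test
  for the weights and the summability of the weighted rate.\<close>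

lemma weight_Suc: "z \<in> state_space m \<Longrightarrow> f (z + 1) * weight \<theta> (z + 1) = exp \<theta> * weight \<theta> z"
  using rate_fact_Suc[of z] f_pos[of z] rate_fact_pos[of z]
  by (simp add: weight_def exp_add field_simps)

lemma weight_uminus: "m = BL \<Longrightarrow> weight \<theta> (- z) = weight (- \<theta>) z"
  by (simp add: weight_def rate_fact_uminus)

lemma summable_weight_nat: "summable (\<lambda>n. weight \<theta> (int n))"
proof -
  have "\<forall>\<^sub>F n in sequentially. 2 * exp \<theta> \<le> f (int n)"
    using f_at_top by (simp add: filterlim_at_top)
  \<comment> \<open>From \<open>N\<close> on, the ratio \<open>exp \<theta> / f (n + 1)\<close> of
    consecutive weights is at most 1/2.\<close>
  then obtain N where N: "\<And>n. n \<ge> N \<Longrightarrow> 2 * exp \<theta> \<le> f (int n)"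
    by (auto simp: eventually_sequentially)
  show ?thesis
  proof (rule summable_ratio_test[of "1/2" N])
    fix n assume "N \<le> n"
    have pos: "weight \<theta> (int n) > 0" "weight \<theta> (int (Suc n)) > 0"
      by (auto intro!: weight_pos nonneg_in_state_space)
    have "2 * exp \<theta> * weight \<theta> (int (Suc n)) \<le> f (int (Suc n)) * weight \<theta> (int (Suc n))"
      using N[of "Suc n"] \<open>N \<le> n\<close> pos by (intro mult_right_mono) auto
    also have "\<dots> = exp \<theta> * weight \<theta> (int n)"
      using weight_Suc[of "int n" \<theta>] by (simp add: nonneg_in_state_space algebra_simps)
    finally have "weight \<theta> (int (Suc n)) \<le> 1 / 2 * weight \<theta> (int n)" by simp
    then show "norm (weight \<theta> (int (Suc n))) \<le> 1 / 2 * norm (weight \<theta> (int n))"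
      using pos by simp
  qed simp
qed

lemma summable_weight: "weight \<theta> summable_on state_space m"
proof -
  have nonneg: "weight \<theta> summable_on {0..}" for \<theta>
  proof -
    have "(\<lambda>n. weight \<theta> (int n)) summable_on UNIV"
      using summable_weight_nat
      by (rule summable_nonneg_imp_summable_on)
        (simp add: less_imp_le weight_pos nonneg_in_state_space)
    moreover have "bij_betw int UNIV {0..}" by (rule bij_betwI[of _ _ _ nat]) auto
    ultimately show ?thesis using summable_on_reindex_bij_betw by blast
  qed
  show ?thesis
  proof (cases m)
    case BL
    \<comment> \<open>Reflection carries one half-line to the other and \<theta> to
      \<open>- \<theta>\<close>.\<close>
    have "bij_betw uminus {0::int..} {..0}" by (rule bij_betwI[of _ _ _ uminus]) auto
    then have "weight \<theta> summable_on {..0}"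
      using nonneg[of "- \<theta>"] summable_on_reindex_bij_betw[of uminus "{0..}" "{..0}" "weight \<theta>"]
      by (simp add: weight_uminus BL)
    then have "weight \<theta> summable_on {0..} \<union> {..0}"
      using nonneg[of \<theta>] by (intro summable_on_union)
    moreover have "{0::int..} \<union> {..0} = UNIV" by auto
    ultimately show ?thesis using BL by simp
  qed (use nonneg in simp)
qed

text \<open>Each summand equals \<open>weight t z\<close> or \<open>weight (- t) z\<close>,
  according to the sign of \<open>z\<close>. This family supplies majorants uniform in \<theta> on
  bounded intervals.\<close>

lemma summable_exp_abs_weight: "(\<lambda>z. exp (t * \<bar>real_of_int z\<bar>) * weight 0 z) summable_on state_space m"
proof (rule summable_on_comparison_test)
  show "(\<lambda>z. weight t z + weight (- t) z) summable_on state_space m"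
    by (intro summable_on_add summable_weight)
  show "exp (t * \<bar>real_of_int z\<bar>) * weight 0 z \<le> weight t z + weight (- t) z"
    if "z \<in> state_space m" for z
    using weight_pos[OF that, of t] weight_pos[OF that, of "- t"]
    by (cases "0 \<le> z") (simp_all add: weight_def)
qed (auto intro!: mult_nonneg_nonneg less_imp_le[OF weight_pos])

lemma weight_le:
  assumes "z \<in> state_space m" "\<bar>\<theta>\<bar> \<le> t"
  shows "weight \<theta> z \<le> exp (t * \<bar>real_of_int z\<bar>) * weight 0 z"
proof -
  have "\<theta> * real_of_int z \<le> t * \<bar>real_of_int z\<bar>"
    using mult_right_mono[OF assms(2), of "\<bar>real_of_int z\<bar>"]
    by (simp flip: abs_mult)
  then show ?thesis
    using rate_fact_pos[OF assms(1)] by (simp add: weight_def divide_right_mono)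
qed

text \<open>The factor \<open>z\<close> is absorbed by
  \<open>\<bar>z\<bar> \<le> exp \<bar>z\<bar>\<close>, at the price of one more unit in the
  exponential rate.\<close>

lemma weight_le_density:
  assumes "z \<in> state_space m" "\<bar>\<theta>\<bar> \<le> t"
  shows "\<bar>weight \<theta> z * real_of_int z\<bar> \<le> exp ((t + 1) * \<bar>real_of_int z\<bar>) * weight 0 z"
proof -
  have "\<bar>real_of_int z\<bar> \<le> exp \<bar>real_of_int z\<bar>"
    using exp_ge_add_one_self[of "\<bar>real_of_int z\<bar>"] by linarith
  then have "weight \<theta> z * \<bar>real_of_int z\<bar> \<le> (exp (t * \<bar>real_of_int z\<bar>) * weight 0 z) * exp \<bar>real_of_int z\<bar>"
    using weight_pos[OF assms(1)] by (intro mult_mono weight_le assms) (auto intro!: less_imp_le)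
  also have "\<dots> = exp ((t + 1) * \<bar>real_of_int z\<bar>) * weight 0 z"
    by (simp add: distrib_right exp_add)
  finally show ?thesis
    using weight_pos[OF assms(1), of \<theta>] by (simp add: abs_mult)
qed

lemma summable_weight_id: "(\<lambda>z. weight \<theta> z * real_of_int z) summable_on state_space m"
proof -
  have "(\<lambda>z. norm (weight \<theta> z * real_of_int z)) summable_on state_space m"
    by (rule summable_on_comparison_test[OF summable_exp_abs_weight[of "\<bar>\<theta>\<bar> + 1"]])
      (use weight_le_density in auto)
  then show ?thesis by (rule abs_summable_summable)
qed

lemma summable_weight_f: "(\<lambda>z. weight \<theta> z * f z) summable_on state_space m"
proof -
  \<comment> \<open>By \<open>weight_Suc\<close> the summand at \<open>z\<close> is
    \<open>exp \<theta> * weight \<theta> (z - 1)\<close>, so its natural index set is the state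
    space shifted by one.\<close>
  let ?S = "{z. z - 1 \<in> state_space m}"
  have "bij_betw (\<lambda>z. z - 1) ?S (state_space m)"
    by (rule bij_betwI[of _ _ _ "\<lambda>z. z + 1"]) auto
  then have "(\<lambda>z. weight \<theta> (z - 1)) summable_on ?S"
    using summable_weight summable_on_reindex_bij_betw by blast
  then have "(\<lambda>z. exp \<theta> * weight \<theta> (z - 1)) summable_on ?S"
    by (rule summable_on_cmult_right)
  also have "?this \<longleftrightarrow> (\<lambda>z. weight \<theta> z * f z) summable_on ?S"
    by (intro summable_on_cong) (use weight_Suc[of "_ - 1" \<theta>] in \<open>auto simp: mult.commute\<close>)
  \<comment> \<open>The shift loses at most the point 0 of \<open>ZR\<close>, where \<open>f\<close>
    vanishes.\<close>
  also have "\<dots> \<longleftrightarrow> ?thesis"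
  proof (rule summable_on_cong_neutral)
    fix z assume "z \<in> state_space m - ?S"
    then have "m = ZR" "z = 0" by (cases m; auto)+
    then show "weight \<theta> z * f z = 0" using rate by simp
  next
    fix z assume "z \<in> ?S - state_space m"
    then show "weight \<theta> z * f z = 0" using state_space_upward[of "z - 1" z] by auto
  qed simp
  finally show ?thesis .
qed

lemma summable_weight_f_uminus:
  assumes "m = BL"
  shows "(\<lambda>z. weight \<theta> z * f (- z)) summable_on state_space m"
proof -
  have "bij_betw uminus (UNIV :: int set) UNIV" by (rule bij_betwI[of _ _ _ uminus]) auto
  from summable_on_reindex_bij_betw[OF this, of "\<lambda>z. weight (- \<theta>) z * f z"]
  show ?thesis using summable_weight_f[of "- \<theta>"] assms by (simp add: weight_uminus)
qed

section \<open>Normalised marginals and one-site expectations\<close>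

definition gibbs :: "real \<Rightarrow> int \<Rightarrow> real" where
  "gibbs \<theta> z = weight \<theta> z / partition_fun m f \<theta>"

lemma partition_fun_eq: "partition_fun m f \<theta> = (\<Sum>\<^sub>\<infinity>z\<in>state_space m. weight \<theta> z)"
  by (simp add: partition_fun_def weight_def)

lemma partition_fun_pos: "partition_fun m f \<theta> > 0"
proof -
  have "sum (weight \<theta>) {0} \<le> partition_fun m f \<theta>"
    unfolding partition_fun_eq
    by (rule finite_sum_le_infsum) (auto intro: summable_weight less_imp_le[OF weight_pos])
  moreover have "weight \<theta> 0 > 0" by (simp add: weight_pos)
  ultimately show ?thesis by simp
qed

lemma gibbs_pos: "z \<in> state_space m \<Longrightarrow> gibbs \<theta> z > 0"
  by (simp add: gibbs_def weight_pos partition_fun_pos)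

lemma summable_gibbs:
  assumes "(\<lambda>z. weight \<theta> z * F z) summable_on state_space m"
  shows "(\<lambda>z. gibbs \<theta> z * F z) summable_on state_space m"
  using summable_on_cmult_right[OF assms, of "inverse (partition_fun m f \<theta>)"]
  by (simp add: gibbs_def field_simps)

lemma has_sum_gibbs: "(gibbs \<theta> has_sum 1) (state_space m)"
  using has_sum_cmult_right[OF has_sum_infsum[OF summable_weight[of \<theta>]], of "inverse (partition_fun m f \<theta>)"]
    partition_fun_pos[of \<theta>]
  by (simp add: gibbs_def[abs_def] partition_fun_eq field_simps)

lemma mu_eq: "mu m f \<theta> = density (count_space (state_space m)) (\<lambda>z. ennreal (gibbs \<theta> z))"
  by (simp add: mu_def point_measure_def gibbs_def weight_def mult.commute)

lemma prob_space_mu: "prob_space (mu m f \<theta>)"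
proof (rule prob_spaceI)
  have "gibbs \<theta> summable_on state_space m" using has_sum_gibbs by (rule has_sum_imp_summable)
  then have "(\<integral>\<^sup>+ z. ennreal (gibbs \<theta> z) \<partial>count_space (state_space m)) = ennreal 1"
    using integral_count_space_eq[of "gibbs \<theta>"] infsumI[OF has_sum_gibbs[of \<theta>]]
    by (subst nn_integral_eq_integral)
      (auto simp: integrable_count_space_iff AE_count_space less_imp_le[OF gibbs_pos])
  moreover have "emeasure (mu m f \<theta>) (space (mu m f \<theta>)) =
      (\<integral>\<^sup>+ z. ennreal (gibbs \<theta> z) \<partial>count_space (state_space m))"
    unfolding mu_eq by (subst emeasure_density) (auto intro!: nn_integral_cong)
  ultimately show "emeasure (mu m f \<theta>) (space (mu m f \<theta>)) = 1" by simp
qed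

lemma
  assumes "(\<lambda>z. weight \<theta> z * F z) summable_on state_space m"
  shows integrable_mu: "integrable (mu m f \<theta>) F"
    and integral_mu: "(LINT z|mu m f \<theta>. F z) = (\<Sum>\<^sub>\<infinity>z\<in>state_space m. gibbs \<theta> z * F z)"
proof -
  have ae: "AE z in count_space (state_space m). 0 \<le> gibbs \<theta> z"
    by (auto simp: AE_count_space less_imp_le[OF gibbs_pos])
  show "integrable (mu m f \<theta>) F"
    unfolding mu_eq using summable_gibbs[OF assms] ae
    by (subst integrable_density) (auto simp: integrable_count_space_iff)
  show "(LINT z|mu m f \<theta>. F z) = (\<Sum>\<^sub>\<infinity>z\<in>state_space m. gibbs \<theta> z * F z)"
    unfolding mu_eq using summable_gibbs[OF assms] ae
    by (subst integral_density) (auto simp: integral_count_space_eq)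
qed

lemma
  assumes "(\<lambda>z. weight \<theta> z * F z) summable_on state_space m"
  shows integrable_stationary: "integrable (stationary_measure m f \<theta>) (\<lambda>\<omega>. F (\<omega> i))"
    and integral_stationary:
      "(LINT \<omega>|stationary_measure m f \<theta>. F (\<omega> i)) = (\<Sum>\<^sub>\<infinity>z\<in>state_space m. gibbs \<theta> z * F z)"
proof -
  let ?P = "stationary_measure m f \<theta>"
  have distr: "distr ?P (mu m f \<theta>) (\<lambda>\<omega>. \<omega> i) = mu m f \<theta>"
    unfolding stationary_measure_def by (rule distr_PiM_component) (auto simp: prob_space_mu)
  have meas: "(\<lambda>\<omega>. \<omega> i) \<in> measurable ?P (mu m f \<theta>)"
    unfolding stationary_measure_def by (rule measurable_component_singleton) simp
  have F: "F \<in> borel_measurable (mu m f \<theta>)" using integrable_mu[OF assms] by auto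
  show "integrable ?P (\<lambda>\<omega>. F (\<omega> i))"
    using integrable_distr_eq[OF meas F] integrable_mu[OF assms] distr by simp
  show "(LINT \<omega>|?P. F (\<omega> i)) = (\<Sum>\<^sub>\<infinity>z\<in>state_space m. gibbs \<theta> z * F z)"
    using integral_distr[OF meas F] integral_mu[OF assms] distr by simp
qed

section \<open>Mean density and mean jump rate as functions of the parameter\<close>

lemma has_sum_mean_density:
  "((\<lambda>z. gibbs \<theta> z * real_of_int z) has_sum mean_density m f \<theta>) (state_space m)"
  using has_sum_infsum[OF summable_gibbs[OF summable_weight_id[of \<theta>]]]
    integral_stationary[OF summable_weight_id[of \<theta>], of 0]
  by (simp add: mean_density_def)

definition mean_rate :: "real \<Rightarrow> real" where
  "mean_rate \<theta> = (LINT \<omega>|stationary_measure m f \<theta>. jump_rate m f (\<omega> 0) (\<omega> 1))"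

text \<open>The rate is a sum of functions of single sites and all sites have the same marginal, so
  the two-site expectation collapses to a one-site sum over the diagonal
  \<open>jump_rate m f z z\<close>.\<close>

lemma has_sum_mean_rate:
  "((\<lambda>z. gibbs \<theta> z * jump_rate m f z z) has_sum mean_rate \<theta>) (state_space m)"
proof (cases m)
  case ZR
  then have "jump_rate m f = (\<lambda>z y. f z)" by (simp add: fun_eq_iff)
  then show ?thesis
    using has_sum_infsum[OF summable_gibbs[OF summable_weight_f[of \<theta>]]]
      integral_stationary[OF summable_weight_f[of \<theta>], of 0]
    by (simp add: mean_rate_def)
next
  case BL
  then have rate_eq: "jump_rate m f = (\<lambda>z y. f z + f (- y))" by (simp add: fun_eq_iff)
  note sf = summable_weight_f[of \<theta>] and sf' = summable_weight_f_uminus[OF BL, of \<theta>]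
  have "mean_rate \<theta> = (\<Sum>\<^sub>\<infinity>z\<in>state_space m. gibbs \<theta> z * f z)
      + (\<Sum>\<^sub>\<infinity>z\<in>state_space m. gibbs \<theta> z * f (- z))"
    unfolding mean_rate_def integral_stationary[OF sf, of 0, symmetric]
      integral_stationary[OF sf', of 1, symmetric]
    using integrable_stationary[OF sf, of 0] integrable_stationary[OF sf', of 1]
    by (subst Bochner_Integration.integral_add[symmetric]) (simp_all add: rate_eq)
  then show ?thesis
    using has_sum_add[OF has_sum_infsum[OF summable_gibbs[OF sf]] has_sum_infsum[OF summable_gibbs[OF sf']]]
    by (simp add: rate_eq distrib_left)
qed

section \<open>Convexity of the jump rate and the strict flux inequality\<close>

lemma convex_seq_jump_rate: "convex_seq (\<lambda>z. jump_rate m f z z)"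
proof (cases m)
  case BL
  have inc: "f (z + 1) - f z \<le> f (z + 2) - f (z + 1)" for z
    using convex_seq_f[unfolded convex_seq_def, rule_format, of z] BL by simp
  show ?thesis
    unfolding convex_seq_def
  proof
    fix z
    \<comment> \<open>Reflection sends the three points \<open>z\<close>, \<open>z + 1\<close>,
      \<open>z + 2\<close> to \<open>- z\<close>, \<open>- z - 1\<close>, \<open>- z - 2\<close>,
      whence the second instance of \<open>inc\<close>.\<close>
    show "jump_rate m f (z + 1) (z + 1) - jump_rate m f z z
        \<le> jump_rate m f (z + 2) (z + 2) - jump_rate m f (z + 1) (z + 1)"
      using inc[of z] inc[of "- z - 2"] by (simp add: BL algebra_simps)
  qed
qed (use convex_seq_f in simp)

text \<open>For \<open>BL\<close> the diagonal rate is even, so an affine one is constant;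
  positivity of both summands then bounds \<open>f\<close>, against its growth. For
  \<open>ZR\<close>, \<open>f 0 = 0\<close> reduces affine to linear.\<close>

lemma jump_rate_not_affine:
  assumes "m = ZR \<Longrightarrow> \<not> linear_rate f"
  shows "\<exists>z\<in>state_space m. jump_rate m f z z \<noteq> A * real_of_int z + B"
proof (rule ccontr)
  assume "\<not> ?thesis"
  then have eq: "jump_rate m f z z = A * real_of_int z + B" if "z \<in> state_space m" for z
    using that by auto
  show False
  proof (cases m)
    case ZR
    then have "B = 0" using eq[of 0] rate by simp
    then have "linear_rate f" unfolding linear_rate_def using eq ZR by auto
    then show False using assms ZR by simp
  next
    case BL
    have "A = 0" using eq[of 1] eq[of "-1"] BL by simp
    then have "f z + f (- z) = B" for z using eq[of z] BL by simp
    moreover have "f z > 0" for z using rate BL by simp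
    ultimately have lt: "f z < B" for z by (metis less_add_same_cancel1)
    have "\<forall>\<^sub>F n in sequentially. B \<le> f (int n)" using f_at_top by (simp add: filterlim_at_top)
    then obtain n where "B \<le> f (int n)" by (auto simp: eventually_sequentially)
    with lt[of "int n"] show False by simp
  qed
qed

text \<open>The likelihood ratio of two marginals is a multiple of one exponential, because
  \<open>rate_fact\<close> cancels.\<close>

lemma gibbs_tilt:
  "gibbs \<theta> z * (partition_fun m f \<theta> / partition_fun m f \<theta>' * exp ((\<theta>' - \<theta>) * real_of_int z)) = gibbs \<theta>' z"
  using partition_fun_pos[of \<theta>]
  by (simp add: gibbs_def weight_def left_diff_distrib exp_diff)

text \<open>Strict convexity of the flux, phrased through parameters so that the inverse of the mean
  density does not enter.\<close>

lemma mean_rate_strictly_convex: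
  assumes nonlin: "m = ZR \<Longrightarrow> \<not> linear_rate f"
    and "\<theta>\<^sub>1 \<noteq> \<theta>\<^sub>2" "u > 0" "v > 0" "u + v = 1"
    and rho: "mean_density m f \<theta> = u * mean_density m f \<theta>\<^sub>1 + v * mean_density m f \<theta>\<^sub>2"
  shows "mean_rate \<theta> < u * mean_rate \<theta>\<^sub>1 + v * mean_rate \<theta>\<^sub>2"
proof -
  \<comment> \<open>\<open>a\<close> and \<open>b\<close> are the coefficients of the exponentials
    in \<open>(u * gibbs \<theta>\<^sub>1 z + v * gibbs \<theta>\<^sub>2 z) / gibbs \<theta>
    z\<close>.\<close>
  define a where "a = u * (partition_fun m f \<theta> / partition_fun m f \<theta>\<^sub>1)"
  define b where "b = v * (partition_fun m f \<theta> / partition_fun m f \<theta>\<^sub>2)"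
  have ab: "a > 0" "b > 0" using assms by (simp_all add: a_def b_def partition_fun_pos)
  define g where "g z = a * exp ((\<theta>\<^sub>1 - \<theta>) * real_of_int z) + b * exp ((\<theta>\<^sub>2 - \<theta>) * real_of_int z) - 1" for z
  have g: "strictly_convex_seq g"
    unfolding strictly_convex_seq_def
  proof
    fix z
    let ?E = "\<lambda>\<alpha>. exp (\<alpha> * (real_of_int z + 2)) - 2 * exp (\<alpha> * (real_of_int z + 1)) + exp (\<alpha> * real_of_int z)"
    have ge: "0 \<le> c * ?E \<alpha>" if "c > 0" for c \<alpha>
      using that convex_exp_increment[of \<alpha> "real_of_int z"] by (intro mult_nonneg_nonneg) auto
    \<comment> \<open>Strictness needs a nonzero exponent; since
      \<open>\<theta>\<^sub>1 \<noteq> \<theta>\<^sub>2\<close>, at least one of the two is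
      nonzero.\<close>
    have gt: "0 < c * ?E \<alpha>" if "c > 0" "\<alpha> \<noteq> 0" for c \<alpha>
      using that(1) strict_convex_exp_increment[OF that(2), of "real_of_int z"] by (intro mult_pos_pos) auto
    have "\<theta>\<^sub>1 - \<theta> \<noteq> 0 \<or> \<theta>\<^sub>2 - \<theta> \<noteq> 0" using assms(2) by auto
    then have "a * ?E (\<theta>\<^sub>1 - \<theta>) + b * ?E (\<theta>\<^sub>2 - \<theta>) > 0"
      by (elim disjE) (intro add_pos_nonneg add_nonneg_pos ge gt ab; assumption)+
    then show "g (z + 1) - g z < g (z + 2) - g (z + 1)"
      unfolding g_def of_int_add of_int_1 of_int_numeral right_diff_distrib distrib_left[of a] distrib_left[of b] by linarith
  qed
  have gibbs_g: "gibbs \<theta> z * g z = u * gibbs \<theta>\<^sub>1 z + v * gibbs \<theta>\<^sub>2 z - gibbs \<theta> z" for z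
    unfolding g_def a_def b_def gibbs_tilt[of \<theta> z \<theta>\<^sub>1, symmetric] gibbs_tilt[of \<theta> z \<theta>\<^sub>2, symmetric]
    by (simp only: algebra_simps)
  have hs: "((\<lambda>z. gibbs \<theta> z * g z * F z) has_sum (u * S1 + v * S2 - S)) (state_space m)"
    if "((\<lambda>z. gibbs \<theta>\<^sub>1 z * F z) has_sum S1) (state_space m)"
      "((\<lambda>z. gibbs \<theta>\<^sub>2 z * F z) has_sum S2) (state_space m)"
      "((\<lambda>z. gibbs \<theta> z * F z) has_sum S) (state_space m)" for F S1 S2 S
    using has_sum_add[OF has_sum_add[OF has_sum_cmult_right[OF that(1), of u]
        has_sum_cmult_right[OF that(2), of v]] has_sum_cmult_right[OF that(3), of "-1"]]
    unfolding gibbs_g by (simp add: algebra_simps)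
  \<comment> \<open>Orthogonality to 1 comes from \<open>u + v = 1\<close>, orthogonality to
    \<open>z\<close> from the hypothesis on the densities.\<close>
  have sum0: "((\<lambda>z. gibbs \<theta> z * g z) has_sum 0) (state_space m)"
    using hs[of "\<lambda>_. 1" 1 1 1] has_sum_gibbs assms(5) by simp
  have sum1: "((\<lambda>z. gibbs \<theta> z * g z * real_of_int z) has_sum 0) (state_space m)"
    using hs[OF has_sum_mean_density has_sum_mean_density has_sum_mean_density] rho by simp
  show ?thesis
    using convex_covariance[OF g convex_seq_jump_rate gibbs_pos sum0 sum1
        hs[OF has_sum_mean_rate has_sum_mean_rate has_sum_mean_rate] jump_rate_not_affine[OF nonlin]]
    by simp
qed

section \<open>Monotonicity, continuity and range of the mean density\<close>

lemma mean_density_strict_mono: "\<theta> < \<theta>' \<Longrightarrow> mean_density m f \<theta> < mean_density m f \<theta>'"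
proof (rule ccontr)
  assume "\<theta> < \<theta>'" and "\<not> ?thesis"
  define c where "c = partition_fun m f \<theta> / partition_fun m f \<theta>'"
  define d where "d = \<theta>' - \<theta>"
  define g where "g z = c * exp (d * real_of_int z) - 1" for z
  have "c > 0" "d > 0" using \<open>\<theta> < \<theta>'\<close> by (simp_all add: c_def d_def partition_fun_pos)
  \<comment> \<open>\<open>s\<close> is the real point where the likelihood ratio
    \<open>c * exp (d * z)\<close> crosses 1, so \<open>g z\<close> and \<open>z - s\<close> have
    the same sign.\<close>
  define s where "s = - ln c / d"
  have gibbs_g: "gibbs \<theta> z * g z = gibbs \<theta>' z - gibbs \<theta> z" for z
    using gibbs_tilt[of \<theta> z \<theta>'] by (simp add: g_def c_def d_def right_diff_distrib)
  have ds: "d * s = - ln c" using \<open>d > 0\<close> by (simp add: s_def)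
  have g_alt: "g z = exp (d * (real_of_int z - s)) - 1" for z
    using \<open>c > 0\<close> by (simp add: g_def right_diff_distrib ds exp_add)
  have sign: "g z * (real_of_int z - s) \<ge> 0" "g z * (real_of_int z - s) = 0 \<Longrightarrow> real_of_int z = s" for z
    unfolding g_alt using \<open>d > 0\<close>
    by (cases "real_of_int z" s rule: linorder_cases;
        auto intro: mult_nonpos_nonpos simp: mult_le_0_iff zero_le_mult_iff)+
  have term_eq: "gibbs \<theta> z * (g z * (real_of_int z - s)) =
      gibbs \<theta>' z * real_of_int z + -1 * (gibbs \<theta> z * real_of_int z)
        + (- s * gibbs \<theta>' z + s * gibbs \<theta> z)" for z
    unfolding mult.assoc[symmetric] gibbs_g by (simp add: algebra_simps)
  have hs: "((\<lambda>z. gibbs \<theta> z * (g z * (real_of_int z - s))) has_sum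
      (mean_density m f \<theta>' - mean_density m f \<theta>)) (state_space m)"
    using has_sum_add[OF has_sum_add[OF has_sum_mean_density[of \<theta>']
        has_sum_cmult_right[OF has_sum_mean_density[of \<theta>], of "-1"]]
      has_sum_add[OF has_sum_cmult_right[OF has_sum_gibbs[of \<theta>'], of "- s"]
        has_sum_cmult_right[OF has_sum_gibbs[of \<theta>], of s]]]
    by (simp only: term_eq) simp
  \<comment> \<open>A nonpositive sum of nonnegative terms has only zero terms, hence
    \<open>z = s\<close> on the whole state space; 0 and 1 lie in both state spaces and already
    conflict.\<close>
  have "real_of_int z = s" if "z \<in> {0, 1}" for z
  proof -
    have z: "z \<in> state_space m" using that nonneg_in_state_space by auto
    have "gibbs \<theta> z * (g z * (real_of_int z - s)) = 0"
      by (rule nonneg_has_sum_le_0D[OF hs _ _ z])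
        (use \<open>\<not> _\<close> sign(1) gibbs_pos in \<open>auto intro!: mult_nonneg_nonneg simp: less_imp_le\<close>)
    then show ?thesis using gibbs_pos[OF z, of \<theta>] sign(2)[of z] by simp
  qed
  from this[of 0] this[of 1] show False by simp
qed

text \<open>Weierstrass M-test on compact intervals. The rate \<open>T + 1\<close> in the bound
  leaves room for the factor \<open>z\<close> of the mean density.\<close>

lemma continuous_weight_sum:
  fixes F :: "int \<Rightarrow> real"
  assumes bound: "\<And>z \<theta> T. z \<in> state_space m \<Longrightarrow> \<bar>\<theta>\<bar> \<le> T \<Longrightarrow>
      \<bar>weight \<theta> z * F z\<bar> \<le> exp ((T + 1) * \<bar>real_of_int z\<bar>) * weight 0 z"
  shows "continuous_on UNIV (\<lambda>\<theta>. \<Sum>\<^sub>\<infinity>z\<in>state_space m. weight \<theta> z * F z)"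
proof -
  have "isCont (\<lambda>\<theta>. \<Sum>\<^sub>\<infinity>z\<in>state_space m. weight \<theta> z * F z) \<theta>\<^sub>0" for \<theta>\<^sub>0
  proof -
    \<comment> \<open>Adding 1 places \<open>\<theta>\<^sub>0\<close> in the interior of
      \<open>{-T..T}\<close>.\<close>
    define T where "T = \<bar>\<theta>\<^sub>0\<bar> + 1"
    have "uniform_limit {-T..T} (\<lambda>X \<theta>. \<Sum>z\<in>X. weight \<theta> z * F z)
        (\<lambda>\<theta>. \<Sum>\<^sub>\<infinity>z\<in>state_space m. weight \<theta> z * F z) (finite_subsets_at_top (state_space m))"
      by (rule Weierstrass_m_test_general[OF _ summable_exp_abs_weight[of "T + 1"]])
        (use bound[of _ _ T] in auto)
    moreover have "\<forall>\<^sub>F X in finite_subsets_at_top (state_space m).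
        continuous_on {-T..T} (\<lambda>\<theta>. \<Sum>z\<in>X. weight \<theta> z * F z)"
    proof (rule eventually_finite_subsets_at_top_weakI)
      fix X assume "finite X" "X \<subseteq> state_space m"
      then have "rate_fact f z \<noteq> 0" if "z \<in> X" for z using rate_fact_pos[of z] that by auto
      then show "continuous_on {-T..T} (\<lambda>\<theta>. \<Sum>z\<in>X. weight \<theta> z * F z)"
        unfolding weight_def by (intro continuous_intros) auto
    qed
    ultimately have "continuous_on {-T..T} (\<lambda>\<theta>. \<Sum>\<^sub>\<infinity>z\<in>state_space m. weight \<theta> z * F z)"
      by (intro uniform_limit_theorem[rotated]) auto
    then show ?thesis
      by (rule continuous_on_interior) (auto simp: T_def)
  qed
  then show ?thesis by (simp add: continuous_at_imp_continuous_on)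
qed

lemma continuous_on_mean_density: "continuous_on UNIV (mean_density m f)"
proof -
  have "continuous_on UNIV (\<lambda>\<theta>. \<Sum>\<^sub>\<infinity>z\<in>state_space m. weight \<theta> z * 1)"
  proof (rule continuous_weight_sum)
    fix z and \<theta> T :: real assume z: "z \<in> state_space m" and "\<bar>\<theta>\<bar> \<le> T"
    then have "weight \<theta> z \<le> exp ((T + 1) * \<bar>real_of_int z\<bar>) * weight 0 z"
      by (intro weight_le) auto
    with weight_pos[OF z, of \<theta>]
    show "\<bar>weight \<theta> z * 1\<bar> \<le> exp ((T + 1) * \<bar>real_of_int z\<bar>) * weight 0 z" by simp
  qed
  then have "continuous_on UNIV (partition_fun m f)" by (simp add: partition_fun_eq[abs_def])
  moreover have "continuous_on UNIV (\<lambda>\<theta>. \<Sum>\<^sub>\<infinity>z\<in>state_space m. weight \<theta> z * real_of_int z)"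
    by (rule continuous_weight_sum) (rule weight_le_density)
  ultimately have "continuous_on UNIV
      (\<lambda>\<theta>. (\<Sum>\<^sub>\<infinity>z\<in>state_space m. weight \<theta> z * real_of_int z) / partition_fun m f \<theta>)"
    by (intro continuous_on_divide) (auto simp: partition_fun_pos[THEN less_imp_neq, symmetric])
  moreover have "mean_density m f =
      (\<lambda>\<theta>. (\<Sum>\<^sub>\<infinity>z\<in>state_space m. weight \<theta> z * real_of_int z) / partition_fun m f \<theta>)"
  proof (intro ext has_sum_unique[OF has_sum_mean_density])
    fix \<theta> show "((\<lambda>z. gibbs \<theta> z * real_of_int z) has_sum
        (\<Sum>\<^sub>\<infinity>z\<in>state_space m. weight \<theta> z * real_of_int z) / partition_fun m f \<theta>) (state_space m)"
      using has_sum_cmult_right[OF has_sum_infsum[OF summable_weight_id[of \<theta>]], of "inverse (partition_fun m f \<theta>)"]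
      by (simp add: gibbs_def field_simps)
  qed
  ultimately show ?thesis by simp
qed

text \<open>A continuous image of the connected real line is connected, hence an interval.\<close>

lemma convex_density_range: "convex (density_range m f)"
  unfolding density_range_def theta_range_UNIV
  using connected_continuous_image[OF continuous_on_mean_density connected_UNIV]
  by (simp add: is_interval_convex_1[symmetric] is_interval_connected_1)

section \<open>The flux as a function of the density\<close>

lemma flux_eq: "flux m f (mean_density m f \<theta>) = mean_rate \<theta>"
proof -
  have "inj (mean_density m f)"
    by (rule strict_mono_imp_inj_on) (simp add: strict_mono_def mean_density_strict_mono)
  then show ?thesis
    by (simp add: flux_def theta_of_density_def theta_range_UNIV mean_rate_def)
qed

lemma strictly_convex_flux:
  assumes "m = ZR \<Longrightarrow> \<not> linear_rate f"
  shows "strictly_convex_on (density_range m f) (flux m f)"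
  unfolding strictly_convex_on_def
proof (intro conjI ballI allI impI convex_density_range)
  fix x y u v
  assume xy: "x \<in> density_range m f" "y \<in> density_range m f"
    and uv: "x \<noteq> y \<and> 0 < u \<and> 0 < v \<and> u + v = (1::real)"
  then have "u * x + v * y \<in> density_range m f"
    using convexD[OF convex_density_range xy, of u v] by simp
  then obtain \<theta> \<theta>\<^sub>1 \<theta>\<^sub>2 where th: "x = mean_density m f \<theta>\<^sub>1" "y = mean_density m f \<theta>\<^sub>2"
    "u * x + v * y = mean_density m f \<theta>"
    using xy by (auto simp: density_range_def)
  have "mean_rate \<theta> < u * mean_rate \<theta>\<^sub>1 + v * mean_rate \<theta>\<^sub>2"
    by (rule mean_rate_strictly_convex[OF assms]) (use uv th in auto)
  then show "flux m f (u * x + v * y) < u * flux m f x + v * flux m f y"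
    using flux_eq th by metis
qed

text \<open>If \<open>f z = c * z\<close>, rate and density are averages of proportional functions.
  Conversely, a linear flux gives equality at the midpoint of two distinct densities, here those of
  the parameters 0 and 1, which contradicts \<open>strictly_convex_flux\<close> unless
  \<open>f\<close> is linear.\<close>

lemma linear_flux_iff:
  assumes "m = ZR"
  shows "linear_flux m f \<longleftrightarrow> linear_rate f"
proof
  assume "linear_rate f"
  then obtain c where c: "\<And>z. z \<ge> 0 \<Longrightarrow> f z = c * real_of_int z" by (auto simp: linear_rate_def)
  have "mean_rate \<theta> = c * mean_density m f \<theta>" for \<theta>
  proof (rule has_sum_unique[OF has_sum_mean_rate])
    have eq: "gibbs \<theta> z * jump_rate m f z z = c * (gibbs \<theta> z * real_of_int z)" if "z \<in> state_space m" for z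
      using that assms c[of z] by simp
    show "((\<lambda>z. gibbs \<theta> z * jump_rate m f z z) has_sum c * mean_density m f \<theta>) (state_space m)"
      by (rule has_sum_cong[OF eq, THEN iffD2, OF _ has_sum_cmult_right[OF has_sum_mean_density]])
  qed
  then show "linear_flux m f" by (auto simp: linear_flux_def density_range_def flux_eq)
next
  assume "linear_flux m f"
  then obtain c where c: "\<And>r. r \<in> density_range m f \<Longrightarrow> flux m f r = c * r"
    by (auto simp: linear_flux_def)
  show "linear_rate f"
  proof (rule ccontr)
    assume "\<not> linear_rate f"
    then have strict: "strictly_convex_on (density_range m f) (flux m f)"
      by (intro strictly_convex_flux)
    define x where "x = mean_density m f 0"
    define y where "y = mean_density m f 1"
    have "x \<noteq> y" using mean_density_strict_mono[of 0 1] by (simp add: x_def y_def)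
    have xy: "x \<in> density_range m f" "y \<in> density_range m f"
      by (simp_all add: x_def y_def density_range_def theta_range_UNIV)
    then have mid: "1 / 2 * x + 1 / 2 * y \<in> density_range m f"
      using convexD[OF convex_density_range, of x y "1 / 2" "1 / 2"] by simp
    have "flux m f (1 / 2 * x + 1 / 2 * y) < 1 / 2 * flux m f x + 1 / 2 * flux m f y"
      by (rule strict[unfolded strictly_convex_on_def, THEN conjunct2, rule_format, OF xy])
        (use \<open>x \<noteq> y\<close> in simp)
    then show False unfolding c[OF mid] c[OF xy(1)] c[OF xy(2)] by (simp add: algebra_simps)
  qed
qed

end

theorem proposition1p7:
  fixes m :: model and f :: "int \<Rightarrow> real"
  assumes "is_rate_function m f"
    and "theta_lower m f < theta_upper f"
    and "convex_rate m f"
  shows "(m = BL \<longrightarrow> strictly_convex_on (density_range m f) (flux m f)) \<and>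
    (m = ZR \<longrightarrow>
       (linear_flux m f \<longleftrightarrow> linear_rate f) \<and>
       (\<not> linear_rate f \<longrightarrow> strictly_convex_on (density_range m f) (flux m f)))"
proof -
  interpret convex_model m f using assms by unfold_locales
  show ?thesis using strictly_convex_flux linear_flux_iff by auto
qed

end
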